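(* Let $T\subseteq S$ be polyhedral cones in a finite-dimensional real vector space, with $S\cap(-S)=\{0\}$. Then the pair $(T,S)$ is free if and only if it is Minkowski linear.
   Context: The relative boundary is $\partial_TS=\{s\in S:(s-T)\cap S=\{s\}\}$; the pair $(T,S)$ is free if the addition map $\partial_TS\times T\to S$ is bijective. Let $V=S-S$ and $W=T-T$ be the real vector spaces spanned by $S$ and $T$, $V^*,W^*$ their duals, $S^\vee\subseteq V^*$ and $T^\vee\subseteq W^*$ the dual cones, $p:V^*\to W^*$ the restriction map (dual to $W\hookrightarrow V$), and $p_+:S^\vee\to T^\vee$ its restriction. For $\xi\in T^\vee$ write $p_+^{-1}(\xi)=p^{-1}(\xi)\cap S^\vee$. The pair $(T,S)$ is Minkowski linear if $p_+$ is surjective and $p_+^{-1}(\xi)+p_+^{-1}(\xi')=p_+^{-1}(\xi+\xi')$ (Minkowski sum) for all $\xi,\xi'\in T^\vee$. *)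

theory Defs
  imports "HOL-Analysis.Analysis" "HOL-Library.Function_Algebras"
begin

definition polyhedral_cone :: "'a::euclidean_space set \<Rightarrow> bool" where
  "polyhedral_cone S \<longleftrightarrow> polyhedron S \<and> convex_cone S"

text \<open>The spaces $V = S - S$ and $W = T - T$ (pointwise differences; not the HOL set
  difference) are rendered as the linear spans, which is justified by the following lemma.\<close>

lemma span_convex_cone_eq_differences:
  fixes S :: "'a::real_vector set"
  assumes "convex_cone S"
  shows "span S = {x - y |x y. x \<in> S \<and> y \<in> S}"
proof
  show "{x - y |x y. x \<in> S \<and> y \<in> S} \<subseteq> span S"
    by (auto intro: span_diff span_base)
  let ?D = "{x - y |x y. x \<in> S \<and> y \<in> S}"
  have S0: "0 \<in> S" using assms by (rule convex_cone_contains_0)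
  have "subspace ?D"
  proof (rule subspaceI)
    show "0 \<in> ?D" using S0 by force
  next
    fix u v assume "u \<in> ?D" "v \<in> ?D"
    then obtain x y x' y' where "u = x - y" "v = x' - y'"
      and "x \<in> S" "y \<in> S" "x' \<in> S" "y' \<in> S" by auto
    then have "u + v = (x + x') - (y + y')" "x + x' \<in> S" "y + y' \<in> S"
      using assms by (auto intro: convex_cone_add)
    then show "u + v \<in> ?D" by blast
  next
    fix c u assume "u \<in> ?D"
    then obtain x y where u: "u = x - y" and xy: "x \<in> S" "y \<in> S" by auto
    show "c *\<^sub>R u \<in> ?D"
    proof (cases "0 \<le> c")
      case True
      then have "c *\<^sub>R u = c *\<^sub>R x - c *\<^sub>R y" "c *\<^sub>R x \<in> S" "c *\<^sub>R y \<in> S"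
        using assms u xy by (auto intro: convex_cone_scaleR simp: scaleR_diff_right)
      then show ?thesis by blast
    next
      case False
      then have "c *\<^sub>R u = (- c) *\<^sub>R y - (- c) *\<^sub>R x" "(- c) *\<^sub>R x \<in> S" "(- c) *\<^sub>R y \<in> S"
        using assms u xy
        by (auto simp: scaleR_diff_right simp del: scaleR_minus_left intro!: convex_cone_scaleR)
           (simp add: scaleR_minus_left)
      then show ?thesis by blast
    qed
  qed
  moreover have "S \<subseteq> ?D" using S0 by force
  ultimately show "span S \<subseteq> ?D" by (rule span_minimal[rotated])
qed

definition relative_boundary :: "'a::ab_group_add set \<Rightarrow> 'a set \<Rightarrow> 'a set" where
  "relative_boundary T S = {s \<in> S. {s - t |t. t \<in> T} \<inter> S = {s}}"

definition free_pair :: "'a::ab_group_add set \<Rightarrow> 'a set \<Rightarrow> bool" where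
  "free_pair T S \<longleftrightarrow> bij_betw (\<lambda>(s, t). s + t) (relative_boundary T S \<times> T) S"

text \<open>A linear functional on a subspace \<open>V\<close> is represented by its extension by \<open>0\<close> outside \<open>V\<close>
  (in general not a linear map on the whole type), so that equality of functionals is equality
  of functions and addition is pointwise addition, as in \<^theory>\<open>HOL-Library.Function_Algebras\<close>.\<close>

definition dual_space :: "'a::real_vector set \<Rightarrow> ('a \<Rightarrow> real) set" where
  "dual_space V = {\<phi>. (\<forall>x\<in>V. \<forall>y\<in>V. \<phi> (x + y) = \<phi> x + \<phi> y) \<and>
                      (\<forall>c. \<forall>x\<in>V. \<phi> (c *\<^sub>R x) = c * \<phi> x) \<and>
                      (\<forall>x. x \<notin> V \<longrightarrow> \<phi> x = 0)}"

definition dual_cone :: "'a::real_vector set \<Rightarrow> ('a \<Rightarrow> real) set" where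
  "dual_cone S = {\<phi> \<in> dual_space (span S). \<forall>x\<in>S. 0 \<le> \<phi> x}"

text \<open>The restriction map $p : V^* \to W^*$, for the above representation of functionals.\<close>

definition dual_restrict :: "'a set \<Rightarrow> ('a \<Rightarrow> real) \<Rightarrow> 'a \<Rightarrow> real" where
  "dual_restrict W \<phi> = (\<lambda>x. if x \<in> W then \<phi> x else 0)"

definition dual_fibre ::
  "'a::real_vector set \<Rightarrow> 'a set \<Rightarrow> ('a \<Rightarrow> real) \<Rightarrow> ('a \<Rightarrow> real) set" where
  "dual_fibre T S \<xi> = {\<phi> \<in> dual_space (span S). dual_restrict (span T) \<phi> = \<xi>} \<inter> dual_cone S"

text \<open>The sum of two fibres is the Minkowski sum of \<^theory>\<open>HOL-Library.Set_Algebras\<close>.\<close>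

definition minkowski_linear :: "'a::real_vector set \<Rightarrow> 'a set \<Rightarrow> bool" where
  "minkowski_linear T S \<longleftrightarrow>
     dual_restrict (span T) ` dual_cone S = dual_cone T \<and>
     (\<forall>\<xi>\<in>dual_cone T. \<forall>\<xi>'\<in>dual_cone T.
        dual_fibre T S \<xi> + dual_fibre T S \<xi>' = dual_fibre T S (\<xi> + \<xi>'))"

end

theory Submission
  imports Defs
begin

text \<open>
  Both conditions are translated into statements about vectors via the Riesz representation, and
  the pointed cone \<open>S\<close> carries a linear functional \<open>e\<close> with \<open>e x \<ge> m \<bar>x\<bar>\<close>, \<open>m > 0\<close>.
  Subtracting from \<open>s\<close> some \<open>t \<in> T\<close> with \<open>s - t \<in> S\<close> and \<open>e t\<close> maximal shows that the addition map is
  always surjective, so freeness amounts to the uniqueness of the boundary part.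

  Suppose that the pair is free, that \<open>\<xi>\<close> is nonnegative on \<open>T\<close>, that \<open>\<phi>\<close> is nonnegative on \<open>S\<close>,
  and that \<open>\<xi> \<le> \<phi>\<close> on \<open>T\<close>. Then \<open>\<xi>\<close> extends to a functional \<open>\<psi>\<close> with \<open>0 \<le> \<psi> \<le> \<phi>\<close> on \<open>S\<close>: the only
  obstruction is some \<open>w = a - b\<close> with \<open>w \<in> W\<close>, \<open>a, b \<in> S\<close> and \<open>\<xi> w > \<phi> a\<close>; but \<open>a\<close> and \<open>b\<close> have the
  same boundary part, so \<open>\<xi> w\<close> is at most \<open>\<xi> t\<close> for the \<open>T\<close>-part \<open>t\<close> of \<open>a\<close>, which is at most
  \<open>\<phi> t \<le> \<phi> a\<close>. Surjectivity of \<open>p\<^sub>+\<close> follows by taking for \<open>\<phi>\<close> a large multiple of \<open>e\<close>, and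
  additivity of the fibres by splitting \<open>\<phi>\<close> as \<open>\<psi> + (\<phi> - \<psi>)\<close>.

  Conversely, let \<open>b + t = b' + t'\<close> with \<open>b, b'\<close> in the relative boundary. It suffices to find \<open>u \<in> S\<close>
  with \<open>b - u, b' - u \<in> T\<close>, as then \<open>b = u = b'\<close>. Otherwise \<open>(b, b')\<close> is separated from the closed cone
  \<open>{(u + \<tau>, u + \<tau>')}\<close> by a pair \<open>(\<alpha>, \<beta>)\<close>, where \<open>\<alpha>, \<beta> \<ge> 0\<close> on \<open>T\<close> and \<open>\<alpha> + \<beta> \<ge> 0\<close> on \<open>S\<close>. Minkowski
  linearity gives \<open>\<alpha> + \<beta> = \<phi> + \<phi>'\<close> with \<open>\<phi>, \<phi>' \<ge> 0\<close> on \<open>S\<close> and \<open>\<phi> = \<alpha>\<close> on \<open>W\<close>, and since \<open>b - b' \<in> W\<close>,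
  \<open>\<alpha> b + \<beta> b' = \<phi> b + \<phi>' b' \<ge> 0\<close>, a contradiction.
\<close>

section \<open>Functionals represented by vectors\<close>

lemma dual_restrict_apply: "x \<in> V \<Longrightarrow> dual_restrict V f x = f x"
  by (simp add: dual_restrict_def)

lemma dual_restrict_eq_iff:
  "dual_restrict V f = dual_restrict V g \<longleftrightarrow> (\<forall>x\<in>V. f x = g x)"
  by (auto simp: dual_restrict_def fun_eq_iff)

lemma dual_restrict_plus:
  "dual_restrict V f + dual_restrict V g = dual_restrict V (\<lambda>x. f x + g x)"
  by (auto simp: dual_restrict_def fun_eq_iff)

lemma dual_restrict_dual_restrict:
  "W \<subseteq> V \<Longrightarrow> dual_restrict W (dual_restrict V f) = dual_restrict W f"
  by (auto simp: dual_restrict_def fun_eq_iff)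

lemma inner_eq_on_span:
  assumes "\<And>x. x \<in> S \<Longrightarrow> inner a x = inner b x" and "x \<in> span S"
  shows "inner a x = inner b x"
  using assms(2) by (induction rule: span_induct_alt) (auto simp: inner_right_distrib assms(1))

text \<open>A member of \<open>dual_space V\<close> need not be linear off \<open>V\<close>. A
  linear map agreeing with it on a basis of \<open>V\<close> agrees with it on all of
  \<open>V\<close>, and the Riesz vector \<open>adjoint g 1\<close> of that map represents
  it.\<close>

lemma dual_space_inner:
  fixes V :: "'a::euclidean_space set"
  assumes V: "subspace V"
  shows "dual_space V = (\<lambda>a. dual_restrict V (inner a)) ` UNIV"
proof (intro equalityI subsetI)
  fix \<phi> assume \<phi>: "\<phi> \<in> dual_space V"
  obtain B where B: "B \<subseteq> V" "independent B" "V \<subseteq> span B"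
    by (metis basis_exists)
  obtain g :: "'a \<Rightarrow> real" where g: "linear g" "\<forall>x\<in>B. g x = \<phi> x"
    using linear_independent_extend[OF B(2)] by blast
  have eq: "x \<in> V \<and> g x = \<phi> x" if "x \<in> span B" for x
    using that
  proof (induction rule: span_induct_alt)
    case base
    have "0 \<in> V" using V by (rule subspace_0)
    then have "\<phi> (0 *\<^sub>R 0) = 0 * \<phi> 0" using \<phi> unfolding dual_space_def by blast
    then show ?case using linear_0[OF g(1)] V by (simp add: subspace_0)
  next
    case (step c x y)
    have x: "x \<in> V" and y: "y \<in> V" and cx: "c *\<^sub>R x \<in> V"
      using step B(1) V by (auto simp: subspace_scale)
    have "\<phi> (c *\<^sub>R x + y) = \<phi> (c *\<^sub>R x) + \<phi> y" "\<phi> (c *\<^sub>R x) = c * \<phi> x"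
      using \<phi> x y cx unfolding dual_space_def by blast+
    then show ?case
      using step g x y cx V by (simp add: linear_add linear_scale subspace_add)
  qed
  have "g x = inner (adjoint g 1) x" for x
    using adjoint_works[OF g(1), of x 1] by (simp add: inner_commute)
  then have "\<phi> = dual_restrict V (inner (adjoint g 1))"
    using eq B(3) \<phi> by (auto simp: dual_restrict_def fun_eq_iff dual_space_def)
  then show "\<phi> \<in> (\<lambda>a. dual_restrict V (inner a)) ` UNIV" by blast
next
  fix \<phi> assume "\<phi> \<in> (\<lambda>a. dual_restrict V (inner a)) ` UNIV"
  then show "\<phi> \<in> dual_space V"
    using V by (auto simp: dual_space_def dual_restrict_def inner_right_distrib
        subspace_add subspace_scale)
qed

lemma dual_cone_inner:
  fixes S :: "'a::euclidean_space set"
  shows "dual_cone S = (\<lambda>a. dual_restrict (span S) (inner a)) ` {a. \<forall>x\<in>S. 0 \<le> inner a x}"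
  unfolding dual_cone_def
  by (auto simp: dual_space_inner dual_restrict_apply span_base)

lemma dual_fibre_inner:
  fixes S T :: "'a::euclidean_space set"
  assumes "T \<subseteq> S"
  shows "dual_fibre T S (dual_restrict (span T) (inner a)) =
    (\<lambda>c. dual_restrict (span S) (inner c)) `
      {c. (\<forall>x\<in>S. 0 \<le> inner c x) \<and> (\<forall>x\<in>T. inner c x = inner a x)}"
proof -
  have "dual_cone S \<subseteq> dual_space (span S)"
    by (auto simp: dual_cone_def)
  moreover have "dual_restrict (span T) (dual_restrict (span S) (inner c)) =
      dual_restrict (span T) (inner a) \<longleftrightarrow> (\<forall>x\<in>T. inner c x = inner a x)" for c
    using inner_eq_on_span[of T c a]
    by (auto simp: dual_restrict_dual_restrict[OF span_mono[OF assms]] dual_restrict_eq_iff span_base)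
  ultimately show ?thesis
    unfolding dual_fibre_def by (auto simp: dual_cone_inner)
qed

text \<open>A functional fixes its vector only up to what is orthogonal to the cone, so equalities
  are tested on \<open>S\<close> or \<open>T\<close>. One inclusion of each set equation is
  automatic; what survives is extending and splitting functionals.\<close>

lemma minkowski_linear_inner:
  fixes S T :: "'a::euclidean_space set"
  assumes TS: "T \<subseteq> S"
  shows "minkowski_linear T S \<longleftrightarrow>
    (\<forall>a. (\<forall>x\<in>T. 0 \<le> inner a x) \<longrightarrow>
       (\<exists>c. (\<forall>x\<in>S. 0 \<le> inner c x) \<and> (\<forall>x\<in>T. inner c x = inner a x))) \<and>
    (\<forall>a b c. (\<forall>x\<in>T. 0 \<le> inner a x) \<longrightarrow> (\<forall>x\<in>T. 0 \<le> inner b x) \<longrightarrow>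
       (\<forall>x\<in>S. 0 \<le> inner c x) \<longrightarrow> (\<forall>x\<in>T. inner c x = inner a x + inner b x) \<longrightarrow>
       (\<exists>a'. (\<forall>x\<in>S. 0 \<le> inner a' x) \<and> (\<forall>x\<in>T. inner a' x = inner a x) \<and>
          (\<exists>b'. (\<forall>x\<in>S. 0 \<le> inner b' x) \<and> (\<forall>x\<in>T. inner b' x = inner b x) \<and>
             (\<forall>x\<in>S. inner a' x + inner b' x = inner c x))))"
    (is "_ \<longleftrightarrow> ?surj \<and> ?add")
proof -
  let ?r = "\<lambda>V a. dual_restrict V (inner (a::'a))"
  let ?F = "\<lambda>a. {c. (\<forall>x\<in>S. 0 \<le> inner c x) \<and> (\<forall>x\<in>T. inner c x = inner a x)}"
  have eqT: "?r (span T) a = ?r (span T) b \<longleftrightarrow> (\<forall>x\<in>T. inner a x = inner b x)" for a b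
    using inner_eq_on_span[of T a b] by (auto simp: dual_restrict_eq_iff span_base)
  have eqS: "?r (span S) a = ?r (span S) b \<longleftrightarrow> (\<forall>x\<in>S. inner a x = inner b x)" for a b
    using inner_eq_on_span[of S a b] by (auto simp: dual_restrict_eq_iff span_base)
  have plus: "?r V a + ?r V b = ?r V (a + b)" for V a b
    by (simp add: dual_restrict_plus inner_add_left[abs_def])
  have res: "dual_restrict (span T) (?r (span S) a) = ?r (span T) a" for a
    using TS by (simp add: dual_restrict_dual_restrict span_mono)
  have image_le: "f ` A \<subseteq> g ` B \<longleftrightarrow> (\<forall>a\<in>A. \<exists>b\<in>B. g b = f a)" for f :: "'a \<Rightarrow> 'b" and g :: "'c \<Rightarrow> 'b" and A B
    by (auto simp: image_subset_iff image_iff eq_commute)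
  have surj: "dual_restrict (span T) ` dual_cone S = dual_cone T \<longleftrightarrow> ?surj"
  proof -
    have img: "dual_restrict (span T) ` dual_cone S = ?r (span T) ` {c. \<forall>x\<in>S. 0 \<le> inner c x}"
      by (simp add: dual_cone_inner image_image res)
    have "?r (span T) ` {c. \<forall>x\<in>S. 0 \<le> inner c x} \<subseteq> dual_cone T"
      unfolding dual_cone_inner using TS by (intro image_mono) auto
    moreover have "dual_cone T \<subseteq> ?r (span T) ` {c. \<forall>x\<in>S. 0 \<le> inner c x} \<longleftrightarrow> ?surj"
      unfolding dual_cone_inner image_le eqT by simp
    ultimately show ?thesis unfolding img by blast
  qed
  have add: "dual_fibre T S (?r (span T) a) + dual_fibre T S (?r (span T) b) =
      dual_fibre T S (?r (span T) a + ?r (span T) b) \<longleftrightarrow>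
      (\<forall>c\<in>?F (a + b). \<exists>a'\<in>?F a. \<exists>b'\<in>?F b. \<forall>x\<in>S. inner a' x + inner b' x = inner c x)"
      (is "?A + ?B = ?C \<longleftrightarrow> ?rhs") for a b
  proof -
    have AB: "?A + ?B = (\<lambda>(a', b'). ?r (span S) (a' + b')) ` (?F a \<times> ?F b)"
      unfolding dual_fibre_inner[OF TS] set_plus_image
      by (simp add: image_paired_Times[symmetric] image_image case_prod_unfold plus)
    have "?A + ?B \<subseteq> ?C"
      unfolding AB unfolding plus dual_fibre_inner[OF TS] by (auto simp: inner_add_left)
    moreover have "?C \<subseteq> ?A + ?B \<longleftrightarrow> ?rhs"
      unfolding AB unfolding plus dual_fibre_inner[OF TS] image_le
      by (simp add: Bex_def case_prod_unfold eqS inner_add_left)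
    ultimately show ?thesis by blast
  qed
  have "(\<forall>\<xi>\<in>dual_cone T. \<forall>\<xi>'\<in>dual_cone T.
        dual_fibre T S \<xi> + dual_fibre T S \<xi>' = dual_fibre T S (\<xi> + \<xi>')) \<longleftrightarrow> ?add"
    unfolding dual_cone_inner[of T] ball_simps add
    by (simp add: inner_add_left Bex_def imp_conjL)
  with surj show ?thesis unfolding minkowski_linear_def by (rule arg_cong2[where f = "(\<and>)"])
qed

section \<open>Pointed cones, closed images and separation\<close>

text \<open>Pointedness makes \<open>S - {0}\<close> convex, so the compact hull of the unit vectors
  of \<open>S\<close> misses 0 and is strictly separated from it; homogeneity spreads the gap
  \<open>m\<close> to all of \<open>S\<close>.\<close>

lemma pointed_cone_positive_functional:
  fixes S :: "'a::euclidean_space set"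
  assumes "closed S" "convex_cone S" "S \<inter> uminus ` S = {0}"
  obtains e m where "0 < m" "\<forall>x\<in>S. m * norm x \<le> inner e x"
proof -
  have ray: "c *\<^sub>R x \<in> S" if "0 \<le> c" "x \<in> S" for c x
    using convex_cone_scaleR[OF assms(2)] that by blast
  let ?C = "convex hull (S \<inter> sphere 0 1)"
  have "convex (S - {0})"
    unfolding convex_def
  proof (intro ballI allI impI)
    fix x y and u v :: real
    assume xy: "x \<in> S - {0}" "y \<in> S - {0}" and uv: "0 \<le> u" "0 \<le> v" "u + v = 1"
    have in_S: "u *\<^sub>R x \<in> S" "v *\<^sub>R y \<in> S" using xy uv ray by auto
    have "u *\<^sub>R x + v *\<^sub>R y \<noteq> 0"
    proof
      assume z: "u *\<^sub>R x + v *\<^sub>R y = 0"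
      then have "u *\<^sub>R x = - (v *\<^sub>R y)" by (simp add: eq_neg_iff_add_eq_0)
      then have "u *\<^sub>R x \<in> S \<inter> uminus ` S" using in_S by auto
      then have "u *\<^sub>R x = 0" using assms(3) by blast
      with z have "u = 0" "v = 0" using xy by auto
      with uv show False by simp
    qed
    then show "u *\<^sub>R x + v *\<^sub>R y \<in> S - {0}"
      using in_S convex_cone_add[OF assms(2)] by blast
  qed
  then have "?C \<subseteq> S - {0}" by (intro hull_minimal) auto
  then have "0 \<notin> ?C" by blast
  moreover have "closed ?C"
    by (rule compact_imp_closed[OF compact_convex_hull[OF closed_Int_compact[OF assms(1) compact_sphere]]])
  ultimately obtain e m where m: "0 < m" "\<And>x. x \<in> ?C \<Longrightarrow> inner e x > m"
    using separating_hyperplane_closed_0[of ?C] convex_convex_hull by metis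
  have "m * norm x \<le> inner e x" if "x \<in> S" for x
  proof (cases "x = 0")
    case False
    then have "x /\<^sub>R norm x \<in> ?C"
      using that ray by (intro hull_inc) auto
    from m(2)[OF this] False show ?thesis by (simp add: field_simps)
  qed simp
  with m(1) that show ?thesis by blast
qed

text \<open>Linear images of closed convex cones may fail to be closed. The norm bound keeps the
  preimages of a convergent sequence bounded, so a subsequence of them converges in
  \<open>X\<close>.\<close>

lemma closed_image_norm_bound:
  fixes h :: "'a::euclidean_space \<Rightarrow> 'b::real_normed_vector"
  assumes "closed X" "continuous_on UNIV h" and bd: "\<And>x. x \<in> X \<Longrightarrow> norm x \<le> K * norm (h x)"
  shows "closed (h ` X)"
  unfolding closed_sequential_limits
proof (intro allI impI, elim conjE)
  fix y l assume y: "\<forall>n. y n \<in> h ` X" and lim: "y \<longlonglongrightarrow> l"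
  then have "\<forall>n. \<exists>x. x \<in> X \<and> y n = h x"
    by blast
  then obtain x where x: "\<And>n. x n \<in> X" "\<And>n. y n = h (x n)"
    using choice[of "\<lambda>n x. x \<in> X \<and> y n = h x"] by blast
  obtain M where M: "\<And>n. norm (y n) \<le> M"
    using convergent_imp_Bseq[OF convergentI[OF lim]] unfolding Bseq_def by blast
  have "norm (x n) \<le> \<bar>K\<bar> * M" for n
  proof -
    have "norm (x n) \<le> K * norm (y n)" using bd[OF x(1)[of n]] x(2)[of n] by simp
    also have "\<dots> \<le> \<bar>K\<bar> * norm (y n)" by (intro mult_right_mono) auto
    also have "\<dots> \<le> \<bar>K\<bar> * M" using M by (intro mult_left_mono) auto
    finally show ?thesis .
  qed
  then have "bounded (range x)" by (auto simp: bounded_iff)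
  then obtain z r where r: "strict_mono r" "(x \<circ> r) \<longlonglongrightarrow> z"
    using bounded_imp_convergent_subsequence by blast
  have "z \<in> X" using closed_sequentially[OF assms(1) _ r(2)] x(1) by simp
  have "(\<lambda>n. h ((x \<circ> r) n)) \<longlonglongrightarrow> h z"
    using assms(2) r(2) by (rule continuous_on_tendsto_compose) auto
  moreover have "(\<lambda>n. h ((x \<circ> r) n)) \<longlonglongrightarrow> l"
    using LIMSEQ_subseq_LIMSEQ[OF lim r(1)] x(2) by (simp add: o_def)
  ultimately have "l = h z" by (rule LIMSEQ_unique[symmetric])
  with \<open>z \<in> X\<close> show "l \<in> h ` X" by blast
qed

lemma separating_functional_convex_cone:
  fixes C :: "'a::euclidean_space set"
  assumes "closed C" "convex_cone C" "z \<notin> C"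
  obtains a where "inner a z < 0" "\<And>x. x \<in> C \<Longrightarrow> 0 \<le> inner a x"
proof -
  obtain a b where ab: "inner a z < b" "\<And>x. x \<in> C \<Longrightarrow> inner a x > b"
    using separating_hyperplane_closed_point[OF _ assms(1,3)] assms(2) unfolding convex_cone_def by blast
  have "b < 0" using ab(2)[OF convex_cone_contains_0[OF assms(2)]] by simp
  have "0 \<le> inner a x" if x: "x \<in> C" for x
  proof (rule ccontr)
    assume "\<not> 0 \<le> inner a x"
    then have neg: "inner a x < 0" by simp
    \<comment> \<open>At this multiple of \<open>x\<close> the functional takes exactly the value
      \<open>b\<close>, against the strict bound on \<open>C\<close>.\<close>
    then have "(b / inner a x) *\<^sub>R x \<in> C"
      using \<open>b < 0\<close> x by (intro convex_cone_scaleR[OF assms(2)]) (auto simp: divide_nonpos_neg)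
    from ab(2)[OF this] neg show False by simp
  qed
  moreover have "inner a z < 0" using ab(1) \<open>b < 0\<close> by simp
  ultimately show ?thesis using that by blast
qed

section \<open>Decomposition along the relative boundary\<close>

lemma relative_boundary_iff:
  assumes "0 \<in> T"
  shows "s \<in> relative_boundary T S \<longleftrightarrow> s \<in> S \<and> (\<forall>t\<in>T. s - t \<in> S \<longrightarrow> t = 0)"
proof
  assume "s \<in> relative_boundary T S"
  then have s: "s \<in> S" and eq: "{s - t |t. t \<in> T} \<inter> S = {s}"
    by (auto simp: relative_boundary_def)
  have "t = 0" if "t \<in> T" "s - t \<in> S" for t
  proof -
    have "s - t \<in> {s}" using that unfolding eq[symmetric] by blast
    then show ?thesis by simp
  qed
  with s show "s \<in> S \<and> (\<forall>t\<in>T. s - t \<in> S \<longrightarrow> t = 0)" by blast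
next
  assume "s \<in> S \<and> (\<forall>t\<in>T. s - t \<in> S \<longrightarrow> t = 0)"
  then show "s \<in> relative_boundary T S"
    using assms unfolding relative_boundary_def by force
qed

lemma relative_boundary_decomposition:
  fixes S T :: "'a::euclidean_space set"
  assumes "closed S" "closed T" "convex_cone T" "T \<subseteq> S"
    and m: "0 < m" "\<forall>x\<in>S. m * norm x \<le> inner e x"
    and "s \<in> S"
  obtains b t where "b \<in> relative_boundary T S" "t \<in> T" "s = b + t"
proof -
  have T0: "0 \<in> T" using assms(3) by (rule convex_cone_contains_0)
  have pos: "0 \<le> inner e x" if "x \<in> S" for x
    using bspec[OF m(2) that] m(1) by (meson mult_nonneg_nonneg norm_ge_zero less_imp_le order_trans)
  let ?Q = "T \<inter> (\<lambda>t. s - t) -` S"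
  \<comment> \<open>Since \<open>s - t\<close> lies in \<open>S\<close>, \<open>e\<close> is at most
    as large at \<open>t\<close> as at \<open>s\<close>, which bounds \<open>?Q\<close>.\<close>
  have "norm t \<le> inner e s / m" if "t \<in> ?Q" for t
  proof -
    have "m * norm t \<le> inner e t" using that assms(4) m(2) by blast
    moreover have "0 \<le> inner e (s - t)" using that pos by blast
    ultimately show ?thesis using m(1) by (simp add: field_simps inner_diff_right)
  qed
  then have "bounded ?Q" by (auto simp: bounded_iff)
  moreover have "closed ?Q"
    using assms(1,2) by (intro closed_Int continuous_closed_vimage) auto
  ultimately have "compact ?Q" by (simp add: compact_eq_bounded_closed)
  moreover have "?Q \<noteq> {}" using T0 assms(7) by auto
  ultimately obtain t where t: "t \<in> ?Q" "\<And>t'. t' \<in> ?Q \<Longrightarrow> inner e t' \<le> inner e t"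
    using continuous_attains_sup[of ?Q "inner e"] continuous_on_inner[OF continuous_on_const continuous_on_id]
    by blast
  have "s - t \<in> relative_boundary T S"
    unfolding relative_boundary_iff[OF T0]
  proof (intro conjI ballI impI)
    show "s - t \<in> S" using t by blast
  next
    \<comment> \<open>If \<open>t'\<close> can still be removed, \<open>t + t'\<close> lies in
      \<open>?Q\<close>; maximality leaves \<open>e\<close> nonpositive at \<open>t'\<close>, which
      forces \<open>t' = 0\<close>.\<close>
    fix t' assume t': "t' \<in> T" "s - t - t' \<in> S"
    then have "t + t' \<in> ?Q"
      using t(1) convex_cone_add[OF assms(3)] by (simp add: diff_diff_eq)
    from t(2)[OF this] have "inner e t' \<le> 0" by (simp add: inner_add_right)
    moreover have "m * norm t' \<le> inner e t'" using t' assms(4) m(2) by blast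
    ultimately have "m * norm t' \<le> 0" by linarith
    then show "t' = 0" using m(1) by (simp add: mult_le_0_iff)
  qed
  with t that[of "s - t" t] show ?thesis by simp
qed

lemma free_pair_iff_unique:
  fixes S T :: "'a::euclidean_space set"
  assumes "closed S" "closed T" "convex_cone S" "convex_cone T" "T \<subseteq> S"
    and m: "0 < m" "\<forall>x\<in>S. m * norm x \<le> inner e x"
  shows "free_pair T S \<longleftrightarrow>
    (\<forall>b\<in>relative_boundary T S. \<forall>t\<in>T. \<forall>b'\<in>relative_boundary T S. \<forall>t'\<in>T.
       b + t = b' + t' \<longrightarrow> b = b')"
proof -
  have "(\<lambda>(s, t). s + t) ` (relative_boundary T S \<times> T) = S"
  proof (intro equalityI subsetI)
    fix s assume "s \<in> S"
    then obtain b t where "b \<in> relative_boundary T S" "t \<in> T" "s = b + t"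
      using relative_boundary_decomposition[OF assms(1,2,4,5) m] by blast
    then show "s \<in> (\<lambda>(s, t). s + t) ` (relative_boundary T S \<times> T)"
      by (intro image_eqI[of _ _ "(b, t)"]) auto
  qed (use assms(5) convex_cone_add[OF assms(3)] in \<open>auto simp: relative_boundary_def\<close>)
  then have "free_pair T S \<longleftrightarrow> inj_on (\<lambda>(s, t). s + t) (relative_boundary T S \<times> T)"
    unfolding free_pair_def bij_betw_def by simp
  also have "\<dots> \<longleftrightarrow> (\<forall>b\<in>relative_boundary T S. \<forall>t\<in>T. \<forall>b'\<in>relative_boundary T S. \<forall>t'\<in>T.
      b + t = b' + t' \<longrightarrow> b = b' \<and> t = t')"
    by (simp add: inj_on_def)
  also have "\<dots> \<longleftrightarrow> (\<forall>b\<in>relative_boundary T S. \<forall>t\<in>T. \<forall>b'\<in>relative_boundary T S. \<forall>t'\<in>T.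
      b + t = b' + t' \<longrightarrow> b = b')"
    by (intro ball_cong refl) auto
  finally show ?thesis .
qed

section \<open>Extension of functionals between two bounds\<close>

lemma span_convex_coneE:
  assumes "convex_cone T" "w \<in> span T"
  obtains t t' where "t \<in> T" "t' \<in> T" "w = t - t'"
  using assms(2) unfolding span_convex_cone_eq_differences[OF assms(1)] by auto

text \<open>Turns the constant lower bound that a separation yields on a cone into a sign condition,
  by scaling.\<close>

lemma bounded_below_multiples_nonneg:
  fixes r :: real
  assumes "\<And>k. 0 \<le> k \<Longrightarrow> c \<le> k * r"
  shows "0 \<le> r"
proof (rule ccontr)
  assume "\<not> 0 \<le> r"
  \<comment> \<open>This multiple of \<open>r\<close> equals \<open>- (\<bar>c\<bar> + 1)\<close>,
    which is below \<open>c\<close>.\<close>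
  moreover from this have "c \<le> ((\<bar>c\<bar> + 1) / - r) * r"
    by (intro assms divide_nonneg_nonneg) auto
  ultimately show False by simp
qed

text \<open>Separating 0 from the convex set \<open>K\<close> gives \<open>(g, c)\<close> with
  \<open>c \<le> 0\<close>; scaling within \<open>W\<close> and \<open>S\<close> yields
  \<open>0 \<le> g \<le> - c p\<close> on \<open>S\<close> and \<open>g = - c x\<close> on
  \<open>W\<close>. Once \<open>c < 0\<close> is known, dividing by \<open>- c\<close> gives
  \<open>f\<close>.\<close>

lemma sandwich_extension:
  fixes S :: "'a::euclidean_space set"
  assumes S: "convex_cone S" and W: "subspace W" "W \<subseteq> span S"
    and dom: "\<forall>w\<in>W. \<forall>b\<in>S. b + w \<in> S \<longrightarrow> inner x w \<le> inner p (b + w)"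
  shows "\<exists>f. (\<forall>s\<in>S. 0 \<le> inner f s \<and> inner f s \<le> inner p s) \<and> (\<forall>w\<in>W. inner f w = inner x w)"
proof -
  define h where "h = (\<lambda>(w, b, a). (w + b - a, inner x w - inner p a))"
  \<comment> \<open>By \<open>dom\<close> the last coordinate of \<open>h\<close> is at most 0
    wherever the first vanishes; the shift by 1 makes it negative, so \<open>K\<close> avoids 0. The
    point \<open>(0, -1)\<close> of \<open>K\<close> later forces \<open>c \<le> 0\<close>.\<close>
  define K where "K = (\<lambda>y. y - (0, 1)) ` h ` (W \<times> S \<times> S)"
  have S0: "0 \<in> S" using S by (rule convex_cone_contains_0)
  have W0: "0 \<in> W" using W(1) by (rule subspace_0)
  have h: "linear h"
    unfolding h_def by (rule linearI) (auto simp: algebra_simps inner_simps)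
  have "convex (W \<times> S \<times> S)"
    using S subspace_imp_convex[OF W(1)] by (intro convex_Times) (auto simp: convex_cone_def)
  then have "convex K"
    unfolding K_def
    by (intro convex_translation_subtract convex_linear_image[OF h])
  moreover have "K \<noteq> {}" unfolding K_def using S0 W0 by auto
  moreover have "0 \<notin> K"
  proof
    assume "0 \<in> K"
    then obtain w b a where wba: "w \<in> W" "b \<in> S" "a \<in> S"
      and eq: "w + b - a = 0" "inner x w - inner p a - 1 = 0"
      unfolding K_def h_def by (auto simp: zero_prod_def)
    have "a = b + w" using eq(1) by (simp add: algebra_simps)
    with dom wba eq(2) show False by fastforce
  qed
  ultimately obtain q where q: "q \<in> span K" "q \<noteq> 0" "\<And>y. y \<in> K \<Longrightarrow> 0 \<le> inner q y"
    using separating_hyperplane_set_0_inspan by blast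
  obtain g c where gc: "q = (g, c)" by (cases q)
  have ineq: "c \<le> inner g (w + b - a) + c * (inner x w - inner p a)"
    if "w \<in> W" "b \<in> S" "a \<in> S" for w b a
  proof -
    have "h (w, b, a) - (0, 1) \<in> K" unfolding K_def using that by blast
    from q(3)[OF this] show ?thesis by (simp add: gc h_def algebra_simps)
  qed
  have "c \<le> 0" using ineq[OF W0 S0 S0] by simp
  have pos_b: "0 \<le> inner g b" if "b \<in> S" for b
  proof (rule bounded_below_multiples_nonneg)
    fix k :: real assume "0 \<le> k"
    then show "c \<le> k * inner g b"
      using ineq[OF W0 convex_cone_scaleR[OF S _ that] S0] by simp
  qed
  have pos_a: "0 \<le> - inner g a - c * inner p a" if "a \<in> S" for a
  proof (rule bounded_below_multiples_nonneg)
    fix k :: real assume "0 \<le> k"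
    then show "c \<le> k * (- inner g a - c * inner p a)"
      using ineq[OF W0 S0 convex_cone_scaleR[OF S _ that], of k] by (simp add: algebra_simps)
  qed
  have pos_w: "0 \<le> inner g w + c * inner x w" if "w \<in> W" for w
  proof (rule bounded_below_multiples_nonneg)
    fix k :: real
    show "c \<le> k * (inner g w + c * inner x w)"
      using ineq[OF subspace_scale[OF W(1) that] S0 S0, of k] by (simp add: algebra_simps)
  qed
  have eq_w: "inner g w + c * inner x w = 0" if "w \<in> W" for w
    using pos_w[OF that] pos_w[OF subspace_neg[OF W(1) that]] by simp
  \<comment> \<open>\<open>K\<close> need not be closed, so the separation is only weak and a
    degenerate \<open>q\<close> must be excluded: for \<open>c = 0\<close>, \<open>g\<close>
    vanishes on \<open>span S\<close>, yet \<open>q\<close> in \<open>span K\<close> puts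
    \<open>g\<close> itself there, so \<open>q = 0\<close>.\<close>
  have "c \<noteq> 0"
  proof
    assume "c = 0"
    then have "inner g s = inner 0 s" if "s \<in> S" for s
      using pos_a[OF that] pos_b[OF that] by simp
    then have orth: "inner g s = 0" if "s \<in> span S" for s
      using inner_eq_on_span[of S g 0] that by simp
    have "K \<subseteq> span S \<times> UNIV"
      using W(2) span_superset[of S] by (auto simp: K_def h_def intro!: span_add span_diff)
    then have "span K \<subseteq> span S \<times> UNIV"
      by (intro span_minimal subspace_Times) auto
    then have "g \<in> span S" using q(1) gc by auto
    then have "g = 0" using orth[of g] by simp
    with \<open>c = 0\<close> gc q(2) show False by (simp add: zero_prod_def)
  qed
  with \<open>c \<le> 0\<close> have c: "c < 0" by simp
  show ?thesis
  proof (intro exI[of _ "g /\<^sub>R (- c)"] conjI ballI)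
    show "0 \<le> inner (g /\<^sub>R (- c)) s" if "s \<in> S" for s
      using pos_b[OF that] c by (simp add: field_simps)
    show "inner (g /\<^sub>R (- c)) s \<le> inner p s" if "s \<in> S" for s
      using pos_a[OF that] c by (simp add: field_simps)
    show "inner (g /\<^sub>R (- c)) w = inner x w" if "w \<in> W" for w
      using eq_w[OF that] c by (simp add: field_simps)
  qed
qed

section \<open>From freeness to Minkowski linearity\<close>

lemma free_pair_extension:
  fixes S T :: "'a::euclidean_space set"
  assumes closed: "closed S" "closed T" and cone: "convex_cone S" "convex_cone T" and TS: "T \<subseteq> S"
    and m: "0 < m" "\<forall>x\<in>S. m * norm x \<le> inner e x"
    and free: "free_pair T S"
    and x: "\<forall>t\<in>T. 0 \<le> inner x t"
    and p: "\<forall>s\<in>S. 0 \<le> inner p s"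
    and xp: "\<forall>t\<in>T. inner x t \<le> inner p t"
  shows "\<exists>f. (\<forall>s\<in>S. 0 \<le> inner f s \<and> inner f s \<le> inner p s) \<and> (\<forall>t\<in>T. inner f t = inner x t)"
proof -
  have dom: "inner x w \<le> inner p a" if w: "w \<in> span T" and ab: "a \<in> S" "b \<in> S" "a = b + w" for w a b
  proof -
    obtain t1 t2 where t12: "t1 \<in> T" "t2 \<in> T" "w = t1 - t2"
      using w cone(2) by (elim span_convex_coneE)
    obtain r t where rt: "r \<in> relative_boundary T S" "t \<in> T" "a = r + t"
      using relative_boundary_decomposition[OF closed cone(2) TS m ab(1)] by blast
    obtain r' t' where rt': "r' \<in> relative_boundary T S" "t' \<in> T" "b = r' + t'"
      using relative_boundary_decomposition[OF closed cone(2) TS m ab(2)] by blast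
    \<comment> \<open>Two decompositions of the same vector \<open>a + t2 = b + t1\<close>.\<close>
    have "r + (t + t2) = r' + (t' + t1)"
      using ab(3) t12(3) rt(3) rt'(3) by (simp add: algebra_simps)
    moreover have "t + t2 \<in> T" "t' + t1 \<in> T"
      using convex_cone_add[OF cone(2)] t12 rt(2) rt'(2) by blast+
    ultimately have "r = r'"
      using free rt(1) rt'(1) unfolding free_pair_iff_unique[OF closed cone TS m] by blast
    then have "w = t - t'" using ab(3) rt(3) rt'(3) by (simp add: algebra_simps)
    then have "inner x w \<le> inner x t" using bspec[OF x rt'(2)] by (simp add: inner_diff_right)
    also have "\<dots> \<le> inner p t" using bspec[OF xp rt(2)] .
    also have "\<dots> \<le> inner p a"
      using p rt by (simp add: inner_add_right relative_boundary_def)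
    finally show ?thesis .
  qed
  have "\<exists>f. (\<forall>s\<in>S. 0 \<le> inner f s \<and> inner f s \<le> inner p s) \<and> (\<forall>w\<in>span T. inner f w = inner x w)"
    using dom by (intro sandwich_extension[OF cone(1) subspace_span span_mono[OF TS]]) simp
  then show ?thesis using span_base[of _ T] by blast
qed

lemma free_imp_minkowski_linear:
  fixes S T :: "'a::euclidean_space set"
  assumes closed: "closed S" "closed T" and cone: "convex_cone S" "convex_cone T" and TS: "T \<subseteq> S"
    and m: "0 < m" "\<forall>x\<in>S. m * norm x \<le> inner e x"
    and free: "free_pair T S"
  shows "minkowski_linear T S"
  unfolding minkowski_linear_inner[OF TS]
proof (intro conjI allI impI)
  fix x assume x: "\<forall>t\<in>T. 0 \<le> inner x t"
  \<comment> \<open>The factor makes \<open>?p\<close> dominate \<open>norm x * norm s\<close> on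
    \<open>S\<close>, hence 0 on \<open>S\<close> and, by Cauchy-Schwarz, \<open>x\<close> on
    \<open>T\<close>.\<close>
  let ?p = "(norm x / m) *\<^sub>R e"
  have bound: "norm x * norm s \<le> inner ?p s" if "s \<in> S" for s
  proof -
    have "(norm x / m) * (m * norm s) \<le> (norm x / m) * inner e s"
      using m(1) by (intro mult_left_mono bspec[OF m(2) that]) simp
    then show ?thesis using m(1) by simp
  qed
  have "0 \<le> inner ?p s" if "s \<in> S" for s
    using bound[OF that] by (meson mult_nonneg_nonneg norm_ge_zero order_trans)
  moreover have "inner x t \<le> inner ?p t" if "t \<in> T" for t
    using bound[of t] that TS norm_cauchy_schwarz[of x t] by (meson order_trans subsetD)
  ultimately show "\<exists>c. (\<forall>s\<in>S. 0 \<le> inner c s) \<and> (\<forall>t\<in>T. inner c t = inner x t)"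
    using free_pair_extension[OF closed cone TS m free x, of ?p] by blast
next
  fix x y p
  assume x: "\<forall>t\<in>T. 0 \<le> inner x t" and y: "\<forall>t\<in>T. 0 \<le> inner y t"
    and p: "\<forall>s\<in>S. 0 \<le> inner p s" "\<forall>t\<in>T. inner p t = inner x t + inner y t"
  have "\<forall>t\<in>T. inner x t \<le> inner p t" using p(2) y by simp
  then obtain f where f: "\<forall>s\<in>S. 0 \<le> inner f s \<and> inner f s \<le> inner p s" "\<forall>t\<in>T. inner f t = inner x t"
    using free_pair_extension[OF closed cone TS m free x p(1)] by blast
  then show "\<exists>a'. (\<forall>s\<in>S. 0 \<le> inner a' s) \<and> (\<forall>t\<in>T. inner a' t = inner x t) \<and>
      (\<exists>b'. (\<forall>s\<in>S. 0 \<le> inner b' s) \<and> (\<forall>t\<in>T. inner b' t = inner y t) \<and>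
        (\<forall>s\<in>S. inner a' s + inner b' s = inner p s))"
    using p(2) by (intro exI[of _ f] conjI exI[of _ "p - f"]) (simp_all add: inner_diff_left)
qed

section \<open>From Minkowski linearity to freeness\<close>

lemma minkowski_linear_imp_free:
  fixes S T :: "'a::euclidean_space set"
  assumes closed: "closed S" "closed T" and cone: "convex_cone S" "convex_cone T" and TS: "T \<subseteq> S"
    and m: "0 < m" "\<forall>x\<in>S. m * norm x \<le> inner e x"
    and lin: "minkowski_linear T S"
  shows "free_pair T S"
  unfolding free_pair_iff_unique[OF closed cone TS m]
proof (intro ballI impI)
  fix b b' t t'
  assume b: "b \<in> relative_boundary T S" and b': "b' \<in> relative_boundary T S"
    and t: "t \<in> T" "t' \<in> T" and eq: "b + t = b' + t'"
  have S0: "0 \<in> S" and T0: "0 \<in> T" using cone convex_cone_contains_0 by blast+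
  define h where "h = (\<lambda>(u, v, w). (u + v, u + w) :: 'a \<times> 'a)"
  have h: "linear h"
    unfolding h_def by (rule linearI) (auto simp: algebra_simps)
  define C where "C = h ` (S \<times> T \<times> T)"
  have "convex_cone C"
    unfolding C_def using cone h by (intro convex_cone_linear_image conjI convex_cone_Times)
  have "closed C"
    unfolding C_def
  proof (rule closed_image_norm_bound)
    show "closed (S \<times> T \<times> T)" using closed by (intro closed_Times)
    show "continuous_on UNIV h" using h by (rule linear_continuous_on[OF linear_conv_bounded_linear[THEN iffD1]])
    fix y assume "y \<in> S \<times> T \<times> T"
    then obtain u v w where y: "y = (u, v, w)" "u \<in> S" "v \<in> T" "w \<in> T" by auto
    have "m * norm u \<le> inner e u" "m * norm v \<le> inner e v" "m * norm w \<le> inner e w"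
      using m(2) y TS by auto
    moreover have "0 \<le> m * norm u" using m(1) by simp
    \<comment> \<open>Pairing with \<open>(e, e)\<close> counts \<open>u\<close> twice; the extra
      copy is nonnegative and is dropped, and each other term bounds one norm.\<close>
    ultimately have "m * (norm u + norm v + norm w) \<le> inner (e, e) (h y)"
      by (simp add: y(1) h_def inner_add_right distrib_left)
    also have "\<dots> \<le> norm (e, e) * norm (h y)" by (rule norm_cauchy_schwarz)
    finally have *: "norm u + norm v + norm w \<le> (norm (e, e) / m) * norm (h y)"
      using m(1) by (simp add: field_simps)
    have "norm y \<le> norm u + norm (v, w)" unfolding y(1) by (rule norm_Pair_le)
    also have "\<dots> \<le> norm u + norm v + norm w" using norm_Pair_le[of v w] by simp
    finally show "norm y \<le> (norm (e, e) / m) * norm (h y)" using * by simp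
  qed
  have "(b, b') \<in> C"
  proof (rule ccontr)
    assume "(b, b') \<notin> C"
    then obtain q where q: "inner q (b, b') < 0" "\<And>y. y \<in> C \<Longrightarrow> 0 \<le> inner q y"
      using separating_functional_convex_cone[OF \<open>closed C\<close> \<open>convex_cone C\<close>] by metis
    obtain x y where xy: "q = (x, y)" by (cases q)
    have nonneg: "0 \<le> inner x (u + v) + inner y (u + w)" if "u \<in> S" "v \<in> T" "w \<in> T" for u v w
    proof -
      have "h (u, v, w) \<in> C" unfolding C_def using that by blast
      from q(2)[OF this] show ?thesis by (simp add: xy h_def)
    qed
    have x: "\<forall>v\<in>T. 0 \<le> inner x v" using nonneg[OF S0 _ T0] by simp
    have y: "\<forall>w\<in>T. 0 \<le> inner y w" using nonneg[OF S0 T0] by simp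
    have p: "\<forall>u\<in>S. 0 \<le> inner (x + y) u" using nonneg[OF _ T0 T0] by (simp add: inner_add_left)
    obtain f g where fg: "\<forall>s\<in>S. 0 \<le> inner f s" "\<forall>s\<in>S. 0 \<le> inner g s"
        "\<forall>s\<in>T. inner f s = inner x s" "\<forall>s\<in>T. inner g s = inner y s"
        "\<forall>s\<in>S. inner f s + inner g s = inner (x + y) s"
      using conjunct2[OF lin[unfolded minkowski_linear_inner[OF TS]], rule_format, of x y "x + y"] x y p
      by (auto simp: inner_add_left)
    have bS: "b \<in> S" "b' \<in> S" using b b' by (auto simp: relative_boundary_def)
    have "inner f b - inner f b' = inner x b - inner x b'"
    proof -
      have bb: "b - b' = t' - t" using eq by (simp add: algebra_simps)
      have "inner f (b - b') = inner x (b - b')"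
        unfolding bb using fg(3) t by (simp add: inner_diff_right)
      then show ?thesis by (simp add: inner_diff_right)
    qed
    moreover have "inner f b' + inner g b' = inner x b' + inner y b'"
      using fg(5) bS(2) by (simp add: inner_add_left)
    moreover have "0 \<le> inner f b" "0 \<le> inner g b'" using fg bS by auto
    moreover have "inner x b + inner y b' < 0" using q(1) xy by simp
    ultimately show False by linarith
  qed
  then obtain u v w where uvw: "u \<in> S" "v \<in> T" "w \<in> T" "b = u + v" "b' = u + w"
    by (auto simp: C_def h_def)
  \<comment> \<open>Both \<open>b - v\<close> and \<open>b' - w\<close> equal \<open>u\<close>,
    which lies in \<open>S\<close>, so the boundary condition kills \<open>v\<close> and
    \<open>w\<close>.\<close>
  have "v = 0" "w = 0"
    using b b' uvw unfolding relative_boundary_iff[OF T0] by simp_all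
  with uvw show "b = b'" by simp
qed

theorem proposition4p4:
  fixes S T :: "'a::euclidean_space set"
  assumes "polyhedral_cone T" and "polyhedral_cone S"
    and "T \<subseteq> S"
    and "S \<inter> uminus ` S = {0}"
  shows "free_pair T S \<longleftrightarrow> minkowski_linear T S"
proof -
  have closed: "closed S" "closed T" and cone: "convex_cone S" "convex_cone T"
    using assms(1,2) by (auto simp: polyhedral_cone_def polyhedron_imp_closed)
  obtain e m where m: "0 < m" "\<forall>x\<in>S. m * norm x \<le> inner e x"
    using pointed_cone_positive_functional[OF closed(1) cone(1) assms(4)] .
  show ?thesis
    by (rule iffI[OF free_imp_minkowski_linear[OF closed cone assms(3) m]
        minkowski_linear_imp_free[OF closed cone assms(3) m]])
qed

end
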